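(* Let $d\ge2$ be an integer and for $n\ge0$ let $S_n=\left[-\lceil n^{(d+1)/d}\rceil,\lceil n^{(d+1)/d}\rceil\right]^d$ (grid graph), $\underline{S}=(S_n)_{n\ge0}$. Then there is a sequence of activated vertices $\underline{v}$ such that $\underline{\delta}(\underline{S},\underline{v})>0$.
   Context: For an integer $a\ge0$, $[-a,a]^d$ denotes the graph on vertex set $[-a,a]^d\subset\mathbb{Z}^d$ in which two vertices are adjacent iff their $L_1$-distance is $1$. Burning process: let $\underline{G}=(G_0,G_1,\dots)$ be graphs with $G_{n-1}$ an induced subgraph of $G_n$ for all $n\ge1$. A sequence of activated vertices is $\underline{v}=(v_n)_{n\ge0}$ with $v_n\in V(G_n)\cup\{\bullet\}$ ($\bullet$ means no vertex is activated). Burning sets: $B_0=\{v_0\}$ (empty if $v_0=\bullet$), and $B_{n+1}=N_{G_{n+1}}[B_n]$ if $v_{n+1}=\bullet$, and $B_{n+1}=N_{G_{n+1}}[B_n]\cup\{v_{n+1}\}$ otherwise, where $N_G[X]$ is the closed neighbourhood of $X$ in $G$. The lower burning density is $\underline{\delta}(\underline{G},\underline{v})=\liminf_{n\to\infty}|B_n|/|V(G_n)|$. *)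

theory Defs
  imports "HOL-Analysis.Analysis" "Graph_Theory.Pair_Digraph" "Graph_Theory.Digraph_Component"
begin

(* Undirected simple graphs are symmetric loop-free digraphs (locale pair_graph):
   an edge uv is the pair of arcs (u,v), (v,u). *)

definition closed_neighbourhood :: "'a pair_pre_digraph \<Rightarrow> 'a set \<Rightarrow> 'a set" where
  "closed_neighbourhood G X = X \<union> {w \<in> pverts G. \<exists>u\<in>X. (u, w) \<in> parcs G}"

definition growing_graphs :: "(nat \<Rightarrow> 'a pair_pre_digraph) \<Rightarrow> bool" where
  "growing_graphs G \<longleftrightarrow>
     (\<forall>n. pair_graph (G n)) \<and>
     (\<forall>n\<ge>1. induced_subgraph (with_proj (G (n - 1))) (with_proj (G n)))"

(* None encodes "no vertex is activated at this step". *)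
definition activation_sequence ::
    "(nat \<Rightarrow> 'a pair_pre_digraph) \<Rightarrow> (nat \<Rightarrow> 'a option) \<Rightarrow> bool" where
  "activation_sequence G v \<longleftrightarrow> (\<forall>n. v n \<in> insert None (Some ` pverts (G n)))"

primrec burning_set ::
    "(nat \<Rightarrow> 'a pair_pre_digraph) \<Rightarrow> (nat \<Rightarrow> 'a option) \<Rightarrow> nat \<Rightarrow> 'a set" where
  "burning_set G v 0 = set_option (v 0)"
| "burning_set G v (Suc n) =
     closed_neighbourhood (G (Suc n)) (burning_set G v n) \<union> set_option (v (Suc n))"

definition lower_burning_density ::
    "(nat \<Rightarrow> 'a pair_pre_digraph) \<Rightarrow> (nat \<Rightarrow> 'a option) \<Rightarrow> ereal" where
  "lower_burning_density G v =
     liminf (\<lambda>n. ereal (real (card (burning_set G v n)) / real (card (pverts (G n)))))"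

definition l1_dist :: "nat \<Rightarrow> (nat \<Rightarrow> int) \<Rightarrow> (nat \<Rightarrow> int) \<Rightarrow> int" where
  "l1_dist d x y = (\<Sum>i<d. \<bar>x i - y i\<bar>)"

(* Points of the d-dimensional integer lattice are functions on {..<d}, extended by
   undefined elsewhere (so that equality of points is equality of functions). *)
definition grid_graph :: "nat \<Rightarrow> int \<Rightarrow> (nat \<Rightarrow> int) pair_pre_digraph" where
  "grid_graph d a =
     \<lparr> pverts = {..<d} \<rightarrow>\<^sub>E {-a..a},
       parcs = {(x, y). x \<in> ({..<d} \<rightarrow>\<^sub>E {-a..a}) \<and> y \<in> ({..<d} \<rightarrow>\<^sub>E {-a..a}) \<and>
                        l1_dist d x y = 1} \<rparr>"

definition growing_grids :: "nat \<Rightarrow> nat \<Rightarrow> (nat \<Rightarrow> int) pair_pre_digraph" where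
  "growing_grids d n = grid_graph d \<lceil>real n powr ((real d + 1) / real d)\<rceil>"

lemma pair_graph_grid_graph: "pair_graph (grid_graph d a)"
proof -
  let ?V = "{..<d} \<rightarrow>\<^sub>E {-a..a}"
  have fin: "finite ?V" by (intro finite_PiE) auto
  have sub: "parcs (grid_graph d a) \<subseteq> ?V \<times> ?V" by (auto simp: grid_graph_def)
  have "finite (parcs (grid_graph d a))"
    using sub fin by (meson finite_SigmaI finite_subset)
  moreover have "sym (parcs (grid_graph d a))"
    by (auto simp: sym_def grid_graph_def l1_dist_def abs_minus_commute)
  ultimately show ?thesis
    using fin sub by unfold_locales (auto simp: grid_graph_def l1_dist_def symmetric_def)
qed

lemma growing_graphs_growing_grids: "growing_graphs (growing_grids d)"
  unfolding growing_graphs_def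
proof (intro conjI allI impI)
  fix n
  show "pair_graph (growing_grids d n)"
    by (simp add: growing_grids_def pair_graph_grid_graph)
next
  fix n :: nat
  assume "n \<ge> 1"
  define a b where "a = \<lceil>real (n - 1) powr ((real d + 1) / real d)\<rceil>"
    and "b = \<lceil>real n powr ((real d + 1) / real d)\<rceil>"
  have "a \<le> b" unfolding a_def b_def by (intro ceiling_mono powr_mono2) auto
  then have mono: "x \<in> ({..<d} \<rightarrow>\<^sub>E {-b..b})" if "x \<in> ({..<d} \<rightarrow>\<^sub>E {-a..a})" for x
    using that PiE_mono[of "{..<d}" "\<lambda>_. {-a..a}" "\<lambda>_. {-b..b}"] by auto
  interpret A: pair_graph "grid_graph d a" by (rule pair_graph_grid_graph)
  interpret B: pair_graph "grid_graph d b" by (rule pair_graph_grid_graph)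
  have "induced_subgraph (with_proj (grid_graph d a)) (with_proj (grid_graph d b))"
    unfolding induced_subgraph_def subgraph_def
    using A.wf_digraph B.wf_digraph mono
    by (auto simp: grid_graph_def compatible_def)
  then show "induced_subgraph (with_proj (growing_grids d (n - 1))) (with_proj (growing_grids d n))"
    by (simp add: growing_grids_def a_def b_def)
qed

end

theory Submission
  imports Defs "HOL-Library.Discrete_Functions"
begin

text \<open>
  Let \<open>m\<close> be a power of two and cut \<open>{0..<m^(d+1)}^d\<close> into \<open>m^d\<close> cubes of side \<open>m^d\<close>. The box lies in
  \<open>S_n\<close> as soon as \<open>n \<ge> m^d\<close>, so during the steps \<open>m^d \<le> n < 2 m^d\<close> there is time to activate
  the lower corner of each cube, and these time windows are disjoint for distinct powers of two. A cube has
  \<open>L_1\<close>-diameter below \<open>d m^d\<close>, so the whole box is burnt from step \<open>(d+2) m^d\<close> on. Until the next power of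
  two takes over, \<open>n\<close> is at most a constant times \<open>m^d\<close>, hence the box keeps a positive proportion of \<open>S_n\<close>.
\<close>

section \<open>Choice of the activated vertices: scales and digits\<close>

definition scale :: "nat \<Rightarrow> nat \<Rightarrow> nat" where
  "scale d n = 2 ^ (floor_log n div d)"

text \<open>The \<open>d\<close> lowest base-\<open>m\<close> digits of the time \<open>n\<close>
  address one of the \<open>m^d\<close> cubes, so counting upwards visits every cube. No step is
  idle; activating an already burnt corner does no harm.\<close>

definition corner_sequence :: "nat \<Rightarrow> nat \<Rightarrow> (nat \<Rightarrow> int) option" where
  "corner_sequence d n =
     (let m = scale d n in Some (\<lambda>i\<in>{..<d}. int (m ^ d * (n div m ^ i mod m))))"

text \<open>For positive \<open>n\<close>, \<open>scale d n\<close> is the largest power of two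
  whose \<open>d\<close>-th power is at most \<open>n\<close>.\<close>

lemma scale_bounds:
  assumes "d > 0" "n > 0"
  shows "scale d n ^ d \<le> n" "n < (2 * scale d n) ^ d"
proof -
  define k where "k = floor_log n div d"
  have "2 ^ (k * d) \<le> (2::nat) ^ floor_log n"
    unfolding k_def by (intro power_increasing) (auto simp: div_times_less_eq_dividend)
  also have "\<dots> \<le> n" using assms floor_log_exp2_le by blast
  finally show "scale d n ^ d \<le> n" by (simp add: scale_def k_def power_mult)
  have "floor_log n < (k + 1) * d"
    unfolding k_def using assms by (metis Suc_eq_plus1 dividend_less_div_times mult_Suc)
  then have "(2::nat) ^ (Suc (floor_log n)) \<le> 2 ^ ((k + 1) * d)"
    by (intro power_increasing) auto
  moreover have "n < 2 ^ Suc (floor_log n)" using floor_log_exp2_gt[of n] by simp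
  ultimately show "n < (2 * scale d n) ^ d"
    by (simp add: scale_def k_def power_add power_mult power_mult_distrib)
qed

lemma scale_eqI:
  assumes "d > 0" "(2 ^ k) ^ d \<le> n" "n < (2 * 2 ^ k) ^ d"
  shows "scale d n = 2 ^ k"
proof -
  have "n > 0" using assms(2) by (metis gr0I not_one_le_zero one_le_numeral one_le_power order_trans)
  have a: "2 ^ (k * d) \<le> n" using assms(2) by (simp add: power_mult)
  have b: "n < 2 ^ ((k + 1) * d)"
    using assms(3) by (simp add: power_add power_mult power_mult_distrib)
  have "2 ^ (k * d) < (2::nat) ^ Suc (floor_log n)"
    using a floor_log_exp2_gt[of n] by simp
  then have "k * d < Suc (floor_log n)" by (rule power_less_imp_less_exp[rotated]) simp
  then have "k * d \<le> floor_log n" by simp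
  moreover have "(2::nat) ^ floor_log n < 2 ^ ((k + 1) * d)"
    using b floor_log_exp2_le[OF \<open>n > 0\<close>] by linarith
  then have "floor_log n < (k + 1) * d" by (rule power_less_imp_less_exp[rotated]) simp
  ultimately have "floor_log n div d = k"
    using assms(1) by (simp add: div_nat_eqI mult.commute)
  then show ?thesis by (simp add: scale_def)
qed

text \<open>The number is \<open>m^d\<close> plus the sum of the \<open>a i * m^i\<close>: a leading
  digit 1 followed by the prescribed digits. The induction splits off the lowest digit.\<close>

lemma digits_exist:
  fixes m :: nat
  assumes "\<And>i. i < d \<Longrightarrow> a i < m"
  shows "\<exists>n. m ^ d \<le> n \<and> n < 2 * m ^ d \<and> (\<forall>i<d. n div m ^ i mod m = a i)"
  using assms
proof (induction d arbitrary: a)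
  case 0
  show ?case by (intro exI[of _ 1]) auto
next
  case (Suc d)
  from Suc.IH[of "\<lambda>i. a (Suc i)"] Suc.prems obtain n
    where n: "m ^ d \<le> n" "n < 2 * m ^ d" "\<forall>i<d. n div m ^ i mod m = a (Suc i)"
    by auto
  have a0: "a 0 < m" using Suc.prems by simp
  have "m * m ^ d \<le> m * n" using n(1) by simp
  \<comment> \<open>Using \<open>Suc n\<close> leaves room for the new digit:
    \<open>a 0 + m * n < m * Suc n\<close>.\<close>
  moreover have "m * Suc n \<le> m * (2 * m ^ d)" using n(2) by (intro mult_le_mono) auto
  moreover have "(a 0 + m * n) div m ^ i mod m = a i" if "i < Suc d" for i
    using that n(3) a0 by (cases i) (auto simp: div_mult2_eq)
  moreover have "m * Suc n = m + m * n" by simp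
  ultimately show ?case using a0
    by (intro exI[of _ "a 0 + m * n"]) (simp add: trans_le_add2)
qed

section \<open>Size and nesting of the grids\<close>

text \<open>At times that are \<open>d\<close>-th powers the radius is an integer and the ceiling
  disappears; the estimates below are made at such times and transferred by monotonicity.\<close>

lemma growing_grids_power:
  assumes "d > 0"
  shows "growing_grids d (q ^ d) = grid_graph d (int (q ^ (d + 1)))"
proof (cases "q = 0")
  case True
  then show ?thesis using assms by (simp add: growing_grids_def zero_power)
next
  case False
  have "real (q ^ d) powr ((real d + 1) / real d) = real q powr (real d * ((real d + 1) / real d))"
    using False by (simp add: powr_powr flip: powr_realpow)
  also have "\<dots> = real q powr real (d + 1)"
    using assms by (simp add: add.commute)
  also have "\<dots> = real (q ^ (d + 1))" using False by (subst powr_realpow) auto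
  finally show ?thesis by (simp only: growing_grids_def ceiling_of_nat)
qed

lemma pverts_grid_graph_mono: "a \<le> b \<Longrightarrow> pverts (grid_graph d a) \<subseteq> pverts (grid_graph d b)"
  by (simp add: grid_graph_def) (intro PiE_mono, auto)

lemma growing_grids_radius_mono:
  "m \<le> n \<Longrightarrow> \<lceil>real m powr ((real d + 1) / real d)\<rceil> \<le> \<lceil>real n powr ((real d + 1) / real d)\<rceil>"
  by (intro ceiling_mono powr_mono2) auto

lemma pverts_growing_grids_mono:
  "m \<le> n \<Longrightarrow> pverts (growing_grids d m) \<subseteq> pverts (growing_grids d n)"
  unfolding growing_grids_def by (intro pverts_grid_graph_mono growing_grids_radius_mono)

lemma parcs_growing_grids:
  "parcs (growing_grids d n) =
     {(x, y). x \<in> pverts (growing_grids d n) \<and> y \<in> pverts (growing_grids d n) \<and> l1_dist d x y = 1}"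
  by (simp add: growing_grids_def grid_graph_def)

lemma activation_sequence_corner_sequence:
  assumes "d > 0"
  shows "activation_sequence (growing_grids d) (corner_sequence d)"
proof -
  have "(\<lambda>i\<in>{..<d}. int (m ^ d * (n div m ^ i mod m))) \<in> pverts (growing_grids d n)"
    if "m = scale d n" for m n
  proof (cases "n = 0")
    \<comment> \<open>At time 0 the scale is 1, every digit is 0, and the only vertex is the
      origin.\<close>
    case True
    then show ?thesis
      using that assms by (auto simp: scale_def growing_grids_def grid_graph_def)
  next
    case False
    have "m > 0" using that by (simp add: scale_def)
    have "m ^ d \<le> n" using scale_bounds(1) that False assms by auto
    have "m ^ d * (n div m ^ i mod m) \<le> m ^ d * m" for i
      using \<open>m > 0\<close> by (intro mult_le_mono) (auto intro: less_imp_le)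
    then have "int (m ^ d * (n div m ^ i mod m)) \<le> int (m ^ (d + 1))" for i
      by (metis of_nat_mono power_Suc2 Suc_eq_plus1)
    then have "(\<lambda>i\<in>{..<d}. int (m ^ d * (n div m ^ i mod m))) \<in> pverts (growing_grids d (m ^ d))"
      unfolding growing_grids_power[OF assms]
      by (auto simp: grid_graph_def intro: order_trans[of _ "0::int"] simp del: of_nat_mult of_nat_power)
    then show ?thesis using pverts_growing_grids_mono[OF \<open>m ^ d \<le> n\<close>] by blast
  qed
  then show ?thesis
    by (auto simp: activation_sequence_def corner_sequence_def Let_def)
qed

section \<open>Spread of the fire and the burnt box\<close>

lemma burning_set_mono: "m \<le> n \<Longrightarrow> burning_set G v m \<subseteq> burning_set G v n"
  by (rule lift_Suc_mono_le[of "burning_set G v"]) (auto simp: closed_neighbourhood_def)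

lemma burning_set_subset_pverts:
  assumes "activation_sequence (growing_grids d) v"
  shows "burning_set (growing_grids d) v n \<subseteq> pverts (growing_grids d n)"
proof (induction n)
  case 0
  have "v 0 \<in> insert None (Some ` pverts (growing_grids d 0))"
    using assms by (simp add: activation_sequence_def)
  then show ?case by auto
next
  case (Suc n)
  have "v (Suc n) \<in> insert None (Some ` pverts (growing_grids d (Suc n)))"
    using assms by (simp add: activation_sequence_def)
  then have "set_option (v (Suc n)) \<subseteq> pverts (growing_grids d (Suc n))" by auto
  with Suc pverts_growing_grids_mono[of n "Suc n" d] show ?case
    by (auto simp: closed_neighbourhood_def)
qed

text \<open>Move one differing coordinate of \<open>x\<close> by one unit towards \<open>p\<close>.
  The new value lies between the two old ones, so the box is not left.\<close>

lemma grid_step_towards: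
  assumes p: "p \<in> pverts (grid_graph d a)" and x: "x \<in> pverts (grid_graph d a)" and "p \<noteq> x"
  obtains y where "y \<in> pverts (grid_graph d a)" "l1_dist d y x = 1"
    "l1_dist d p y + 1 = l1_dist d p x"
proof -
  have in_box: "p \<in> {..<d} \<rightarrow>\<^sub>E {-a..a}" "x \<in> {..<d} \<rightarrow>\<^sub>E {-a..a}"
    using p x by (simp_all add: grid_graph_def)
  obtain i where i: "i < d" "p i \<noteq> x i"
    using PiE_ext[OF in_box] \<open>p \<noteq> x\<close> by blast
  define y where "y = x(i := x i + sgn (p i - x i))"
  have pi: "p i \<in> {-a..a}" and xi: "x i \<in> {-a..a}"
    using i in_box[THEN PiE_mem, of i] by simp_all
  have "x i + sgn (p i - x i) \<in> {-a..a}"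
    using pi xi i(2) by (auto simp: sgn_if)
  then have "y \<in> pverts (grid_graph d a)"
    using PiE_fun_upd[OF _ in_box(2), of _ i] i(1)
    unfolding y_def grid_graph_def by (simp add: insert_absorb)
  moreover have "l1_dist d y x = (\<Sum>j<d. if j = i then 1 else 0)"
    unfolding l1_dist_def using i by (intro sum.cong) (auto simp: y_def sgn_if)
  then have "l1_dist d y x = 1" using i by simp
  moreover have "l1_dist d p x = (\<Sum>j<d. \<bar>p j - y j\<bar> + (if j = i then 1 else 0))"
    unfolding l1_dist_def using i by (intro sum.cong) (auto simp: y_def sgn_if)
  then have "l1_dist d p y + 1 = l1_dist d p x" using i by (simp add: l1_dist_def sum.distrib)
  ultimately show ?thesis using that by blast
qed

text \<open>Fire advances one unit per step along a shortest path from \<open>p\<close> to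
  \<open>x\<close>. Such a path can be kept inside the box at time \<open>t\<close>, hence inside
  all later grids.\<close>

lemma burning_set_l1_ball:
  assumes "p \<in> burning_set (growing_grids d) v t" "p \<in> pverts (growing_grids d t)"
    and "x \<in> pverts (growing_grids d t)" "l1_dist d p x \<le> int r"
  shows "x \<in> burning_set (growing_grids d) v (t + r)"
  using assms(3,4)
proof (induction r arbitrary: x)
  case 0
  have "p = x"
  proof (rule ccontr)
    assume "p \<noteq> x"
    \<comment> \<open>A further step towards \<open>p\<close> would make the distance
      negative.\<close>
    then obtain y where "l1_dist d p y + 1 = l1_dist d p x"
      using grid_step_towards assms(2) 0(1) unfolding growing_grids_def by metis
    moreover have "l1_dist d p y \<ge> 0" by (simp add: l1_dist_def sum_nonneg)
    ultimately show False using 0(2) by simp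
  qed
  then show ?case using assms(1) by simp
next
  case (Suc r)
  show ?case
  proof (cases "p = x")
    case True
    then show ?thesis using assms(1) burning_set_mono[of t "t + Suc r"] by (meson le_add1 subsetD)
  next
    case False
    then obtain y where y: "y \<in> pverts (growing_grids d t)" "l1_dist d y x = 1"
        "l1_dist d p y + 1 = l1_dist d p x"
      using grid_step_towards assms(2) Suc.prems(1) unfolding growing_grids_def by metis
    have "y \<in> burning_set (growing_grids d) v (t + r)"
      using Suc.IH[OF y(1)] y(3) Suc.prems(2) by simp
    moreover have "pverts (growing_grids d t) \<subseteq> pverts (growing_grids d (Suc (t + r)))"
      by (rule pverts_growing_grids_mono) simp
    ultimately show ?thesis
      using y(1,2) Suc.prems(1) by (auto simp: closed_neighbourhood_def parcs_growing_grids)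
  qed
qed

text \<open>Time budget: each corner is activated before time \<open>2 * m^d\<close>, and crossing
  its cube takes at most \<open>m^d\<close> steps in each of the \<open>d\<close>
  directions.\<close>

lemma box_burnt:
  assumes "d > 0" and m: "m = 2 ^ k" and n: "(d + 2) * m ^ d \<le> n"
  shows "({..<d} \<rightarrow>\<^sub>E int ` {..<m ^ (d + 1)}) \<subseteq> burning_set (growing_grids d) (corner_sequence d) n"
proof
  fix x assume x: "x \<in> {..<d} \<rightarrow>\<^sub>E int ` {..<m ^ (d + 1)}"
  have mpos: "m > 0" using m by simp
  define z where "z i = nat (x i)" for i
  have z: "x i = int (z i)" "z i < m ^ d * m" if "i < d" for i
    using x that by (auto simp: z_def PiE_def Pi_def mult.commute)
  \<comment> \<open>The quotients \<open>z i div m^d\<close> index the cube containing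
    \<open>x\<close>; they are the digits that \<open>t\<close> must have.\<close>
  obtain t where t: "m ^ d \<le> t" "t < 2 * m ^ d" "\<forall>i<d. t div m ^ i mod m = z i div m ^ d"
    using digits_exist[of d "\<lambda>i. z i div m ^ d" m] z(2)
    by (metis less_mult_imp_div_less mult.commute)
  have "2 ^ 1 \<le> (2::nat) ^ d" using assms(1) by (intro power_increasing) auto
  then have "2 * m ^ d \<le> (2 * m) ^ d" by (simp add: power_mult_distrib)
  then have "t < (2 * m) ^ d" using t(2) by linarith
  then have sc: "scale d t = m"
    using scale_eqI[of d k t] t(1) assms(1) by (simp only: m)
  define p :: "nat \<Rightarrow> int" where "p = (\<lambda>i\<in>{..<d}. int (m ^ d * (t div m ^ i mod m)))"
  have v: "corner_sequence d t = Some p" by (simp add: corner_sequence_def sc p_def)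
  have "p \<in> burning_set (growing_grids d) (corner_sequence d) t"
    using v by (cases t) auto
  moreover from this have "p \<in> pverts (growing_grids d t)"
    using burning_set_subset_pverts activation_sequence_corner_sequence[OF assms(1)] by blast
  moreover have "int ` {..<N} \<subseteq> {- int N..int N}" for N
    by auto
  then have "x \<in> {..<d} \<rightarrow>\<^sub>E {- int (m ^ (d + 1))..int (m ^ (d + 1))}"
    by (intro subsetD[OF PiE_mono x])
  then have "x \<in> pverts (growing_grids d (m ^ d))"
    unfolding growing_grids_power[OF assms(1)] by (simp only: grid_graph_def pair_pre_digraph.simps)
  then have "x \<in> pverts (growing_grids d t)" using pverts_growing_grids_mono t(1) by blast
  moreover have "l1_dist d p x \<le> (\<Sum>i<d. int (m ^ d))"
    unfolding l1_dist_def
  proof (rule sum_mono)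
    fix i assume "i \<in> {..<d}"
    then have i: "i < d" by simp
    \<comment> \<open>In each coordinate \<open>x\<close> exceeds the corner \<open>p\<close> by the
      remainder of \<open>z i\<close> modulo \<open>m^d\<close>.\<close>
    have "p i = int (m ^ d * (z i div m ^ d))" using i t(3) by (simp add: p_def)
    moreover have "x i = int (m ^ d * (z i div m ^ d)) + int (z i mod m ^ d)"
      using z(1)[OF i] by (metis mult_div_mod_eq of_nat_add)
    moreover have "z i mod m ^ d < m ^ d" using mpos by simp
    then have "int (z i mod m ^ d) \<le> int (m ^ d)" by linarith
    ultimately show "\<bar>p i - x i\<bar> \<le> int (m ^ d)" by linarith
  qed
  then have "l1_dist d p x \<le> int (d * m ^ d)" by simp
  ultimately have "x \<in> burning_set (growing_grids d) (corner_sequence d) (t + d * m ^ d)"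
    by (rule burning_set_l1_ball)
  moreover have "t + d * m ^ d \<le> n"
  proof -
    have "(d + 2) * m ^ d = d * m ^ d + 2 * m ^ d" by (rule add_mult_distrib)
    then show ?thesis using t(2) n by linarith
  qed
  ultimately show "x \<in> burning_set (growing_grids d) (corner_sequence d) n"
    by (meson burning_set_mono subsetD)
qed

section \<open>Counting and the density\<close>

lemma card_pverts_grid_graph: "a \<ge> 0 \<Longrightarrow> card (pverts (grid_graph d a)) = nat (2 * a + 1) ^ d"
  by (simp add: grid_graph_def card_PiE)

lemma finite_pverts_growing_grids: "finite (pverts (growing_grids d n))"
  by (simp add: growing_grids_def grid_graph_def finite_PiE)

text \<open>A burnt box of side \<open>m^(d+1)\<close> is compared with a grid of side at most
  \<open>c * m^(d+1)\<close>. In \<open>c\<close>, the factor 3 absorbs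
  \<open>2 * r + 1 \<le> 3 * r\<close>, and \<open>2 * (d + 2)\<close> comes from
  \<open>n \<le> (2 * (d + 2) * m)^d\<close>.\<close>

lemma density_bound:
  fixes d n :: nat
  assumes "d > 0" "n \<ge> d + 2"
  defines "c \<equiv> 3 * (2 * (d + 2)) ^ (d + 1)"
  shows "1 / real c ^ d \<le>
    real (card (burning_set (growing_grids d) (corner_sequence d) n)) / real (card (pverts (growing_grids d n)))"
    (is "_ \<le> real ?B / real ?V")
proof -
  \<comment> \<open>Dividing by \<open>d + 2\<close> makes the scale of \<open>q\<close> small
    enough for its box to be burnt by time \<open>n\<close>.\<close>
  define q where "q = n div (d + 2)"
  define m where "m = scale d q"
  have "q > 0" unfolding q_def using assms(2) by (simp add: div_greater_zero_iff)
  note s = scale_bounds[OF assms(1) \<open>q > 0\<close>, folded m_def]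
  have mpos: "m > 0" by (simp add: m_def scale_def)
  have "(d + 2) * m ^ d \<le> (d + 2) * q" using s(1) by (rule mult_le_mono2)
  also have "\<dots> \<le> n" unfolding q_def by (rule times_div_less_eq_dividend)
  finally have "({..<d} \<rightarrow>\<^sub>E int ` {..<m ^ (d + 1)}) \<subseteq> burning_set (growing_grids d) (corner_sequence d) n"
    by (intro box_burnt[OF assms(1)]) (simp_all add: m_def scale_def)
  moreover have "finite (burning_set (growing_grids d) (corner_sequence d) n)"
    using burning_set_subset_pverts[OF activation_sequence_corner_sequence[OF assms(1)]]
      finite_pverts_growing_grids finite_subset by blast
  ultimately have "card ({..<d} \<rightarrow>\<^sub>E int ` {..<m ^ (d + 1)}) \<le> ?B" by (intro card_mono)
  then have B: "(m ^ (d + 1)) ^ d \<le> ?B" by (simp add: card_PiE card_image)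
  have "n < (d + 2) * Suc q" unfolding q_def by (metis dividend_less_times_div mult_Suc_right zero_less_Suc add_2_eq_Suc')
  \<comment> \<open>Enlarging \<open>d + 2\<close> to its \<open>d\<close>-th power gives a time at
    which the radius is exact.\<close>
  also have "\<dots> \<le> (d + 2) ^ d * (2 * m) ^ d"
    using s(2) assms(1) by (intro mult_le_mono) (auto intro: self_le_power)
  also have "\<dots> = (2 * (d + 2) * m) ^ d"
    by (metis mult.assoc mult.commute power_mult_distrib)
  finally have n: "n \<le> (2 * (d + 2) * m) ^ d" by simp
  let ?r = "(2 * (d + 2) * m) ^ (d + 1)"
  have "?V \<le> card (pverts (growing_grids d ((2 * (d + 2) * m) ^ d)))"
    by (intro card_mono finite_pverts_growing_grids pverts_growing_grids_mono n)
  also have "\<dots> = nat (2 * int ?r + 1) ^ d"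
    unfolding growing_grids_power[OF assms(1)] by (rule card_pverts_grid_graph) simp
  also have "nat (2 * int ?r + 1) = 2 * ?r + 1" by linarith
  also have "(2 * ?r + 1) ^ d \<le> (3 * ?r) ^ d"
  proof (rule power_mono)
    have "?r \<ge> 1" using mpos by (intro one_le_power) simp
    then show "2 * ?r + 1 \<le> 3 * ?r" by linarith
  qed simp
  also have "\<dots> = c ^ d * (m ^ (d + 1)) ^ d"
    unfolding c_def by (simp only: power_mult_distrib mult.assoc)
  also have "\<dots> \<le> c ^ d * ?B" using B by (rule mult_le_mono2)
  finally have V: "real ?V \<le> real c ^ d * real ?B" by (metis of_nat_le_iff of_nat_mult of_nat_power)
  \<comment> \<open>A nonempty burnt set forces a nonzero denominator, which clearing fractions
    requires.\<close>
  have "0 < (m ^ (d + 1)) ^ d" using mpos by simp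
  then have "0 < ?B" using B by linarith
  then have "0 < ?V"
    using burning_set_subset_pverts[OF activation_sequence_corner_sequence[OF assms(1)], of n]
      finite_pverts_growing_grids[of d n] by (metis card_gt_0_iff subset_empty)
  moreover have "c > 0" by (simp add: c_def)
  ultimately show ?thesis using V by (simp add: field_simps)
qed

theorem theorem12:
  fixes d :: nat
  assumes "d \<ge> 2"
  shows "\<exists>v. activation_sequence (growing_grids d) v \<and>
             lower_burning_density (growing_grids d) v > 0"
proof (intro exI conjI)
  have "d > 0" using assms by simp
  then show "activation_sequence (growing_grids d) (corner_sequence d)"
    by (rule activation_sequence_corner_sequence)
  define c where "c = 3 * (2 * (d + 2)) ^ (d + 1)"
  have "c > 0" by (simp add: c_def)
  then have "0 < ereal (1 / real c ^ d)" by simp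
  also have "\<dots> \<le> lower_burning_density (growing_grids d) (corner_sequence d)"
    unfolding lower_burning_density_def
    using density_bound[OF \<open>d > 0\<close>, folded c_def]
    by (intro Liminf_bounded) (auto simp: eventually_at_top_linorder)
  finally show "lower_burning_density (growing_grids d) (corner_sequence d) > 0" .
qed

end
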